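(* Mixed strong Nash equilibria of three-player games may have outcomes that are strictly Pareto dominated: there exist a finite three-player strategic-form game and a strong Nash equilibrium $\bar x$ of it in mixed (non-pure) strategies such that some pure-strategy profile (outcome) in the support of $\bar x$ (i.e. occurring with positive probability under $\bar x$) is strictly Pareto dominated. The same holds with "super strong Nash equilibrium" in place of "strong Nash equilibrium".
   Context: In an $n$-player finite strategic-form game, player $i\in N=\{1,\dots,n\}$ has a finite set $A_i$ of actions and a utility function $U_i:A_1\times\dots\times A_n\to\mathbb{R}$. A mixed strategy of player $i$ is a vector $x_i$ in the simplex $\Delta_i$ of probability distributions on $A_i$. At a profile $x=(x_1,\dots,x_n)$ (players randomizing independently) the utility of player $i$ is the expected utility $v_i(x)=\sum_{i_1,\dots,i_n}U_i(i_1,\dots,i_n)\,x_{1i_1}\cdots x_{ni_n}$. A profile $\bar x$ is a Nash equilibrium if $v_i(\bar x)\ge v_i(x_i,\bar x_{-i})$ for each $i$ and each $x_i\in\Delta_i$. A profile $z$ is strictly Pareto dominated if there is a profile $y$ of mixed strategies with $v_i(y)>v_i(z)$ for all $i\in N$. For a coalition $C$ (a nonempty subset of $N$), a profile $\bar x$ is weakly Pareto efficient for $C$ if there is no profile $y$, with $y_i=\bar x_i$ for all $i\notin C$ and $y_i\in\Delta_i$ arbitrary for $i\in C$, such that $v_i(y)>v_i(\bar x)$ for all $i\in C$. It is strictly Pareto efficient for $C$ if there is no such $y$ with $v_i(y)\ge v_i(\bar x)$ for all $i\in C$ and strict inequality for at least one $i\in C$. A strong (respectively super strong) Nash equilibrium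 is a Nash equilibrium that is weakly (respectively strictly) Pareto efficient for every coalition. *)

theory Defs
  imports Complex_Main "HOL-Library.FuncSet"
begin

(* The players are 1, ..., num_players.  Only the values of actions and utility at players,
   and of utility at elements of the product of the action sets, are relevant. *)
record 'a game =
  num_players :: nat
  actions :: "nat \<Rightarrow> 'a set"
  utility :: "nat \<Rightarrow> (nat \<Rightarrow> 'a) \<Rightarrow> real"

definition players :: "'a game \<Rightarrow> nat set" where
  "players G = {1..num_players G}"

definition finite_game :: "'a game \<Rightarrow> bool" where
  "finite_game G \<longleftrightarrow>
     players G \<noteq> {} \<and> (\<forall>i\<in>players G. finite (actions G i) \<and> actions G i \<noteq> {})"

definition outcomes :: "'a game \<Rightarrow> (nat \<Rightarrow> 'a) set" where
  "outcomes G = (\<Pi>\<^sub>E i\<in>players G. actions G i)"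

(* Vectors indexed by A are functions on the whole type that vanish outside A. *)
definition mixed_strategies :: "'a set \<Rightarrow> ('a \<Rightarrow> real) set" where
  "mixed_strategies A =
     {p. (\<forall>a\<in>A. 0 \<le> p a) \<and> (\<forall>a. a \<notin> A \<longrightarrow> p a = 0) \<and> (\<Sum>a\<in>A. p a) = 1}"

definition mixed_profiles :: "'a game \<Rightarrow> (nat \<Rightarrow> 'a \<Rightarrow> real) set" where
  "mixed_profiles G = (\<Pi>\<^sub>E i\<in>players G. mixed_strategies (actions G i))"

definition expected_utility :: "'a game \<Rightarrow> nat \<Rightarrow> (nat \<Rightarrow> 'a \<Rightarrow> real) \<Rightarrow> real" where
  "expected_utility G i x =
     (\<Sum>a\<in>outcomes G. utility G i a * (\<Prod>j\<in>players G. x j (a j)))"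

(* The pure-strategy profile a, viewed as a profile of degenerate mixed strategies. *)
definition pure_profile :: "'a game \<Rightarrow> (nat \<Rightarrow> 'a) \<Rightarrow> (nat \<Rightarrow> 'a \<Rightarrow> real)" where
  "pure_profile G a = (\<lambda>i\<in>players G. \<lambda>k. if k = a i then 1 else 0)"

definition is_pure :: "'a game \<Rightarrow> (nat \<Rightarrow> 'a \<Rightarrow> real) \<Rightarrow> bool" where
  "is_pure G x \<longleftrightarrow> (\<exists>a\<in>outcomes G. x = pure_profile G a)"

definition support :: "'a game \<Rightarrow> (nat \<Rightarrow> 'a \<Rightarrow> real) \<Rightarrow> (nat \<Rightarrow> 'a) set" where
  "support G x = {a \<in> outcomes G. (\<Prod>i\<in>players G. x i (a i)) > 0}"

definition nash_equilibrium :: "'a game \<Rightarrow> (nat \<Rightarrow> 'a \<Rightarrow> real) \<Rightarrow> bool" where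
  "nash_equilibrium G x \<longleftrightarrow>
     x \<in> mixed_profiles G \<and>
     (\<forall>i\<in>players G. \<forall>p\<in>mixed_strategies (actions G i).
        expected_utility G i x \<ge> expected_utility G i (x(i := p)))"

definition strictly_pareto_dominated :: "'a game \<Rightarrow> (nat \<Rightarrow> 'a \<Rightarrow> real) \<Rightarrow> bool" where
  "strictly_pareto_dominated G z \<longleftrightarrow>
     (\<exists>y\<in>mixed_profiles G. \<forall>i\<in>players G. expected_utility G i y > expected_utility G i z)"

definition coalitions :: "'a game \<Rightarrow> nat set set" where
  "coalitions G = {C. C \<subseteq> players G \<and> C \<noteq> {}}"

definition coalition_deviations ::
  "'a game \<Rightarrow> nat set \<Rightarrow> (nat \<Rightarrow> 'a \<Rightarrow> real) \<Rightarrow> (nat \<Rightarrow> 'a \<Rightarrow> real) set" where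
  "coalition_deviations G C x =
     {y \<in> mixed_profiles G. \<forall>i\<in>players G - C. y i = x i}"

definition weakly_pareto_efficient_for ::
  "'a game \<Rightarrow> nat set \<Rightarrow> (nat \<Rightarrow> 'a \<Rightarrow> real) \<Rightarrow> bool" where
  "weakly_pareto_efficient_for G C x \<longleftrightarrow>
     \<not> (\<exists>y\<in>coalition_deviations G C x.
          \<forall>i\<in>C. expected_utility G i y > expected_utility G i x)"

definition strictly_pareto_efficient_for ::
  "'a game \<Rightarrow> nat set \<Rightarrow> (nat \<Rightarrow> 'a \<Rightarrow> real) \<Rightarrow> bool" where
  "strictly_pareto_efficient_for G C x \<longleftrightarrow>
     \<not> (\<exists>y\<in>coalition_deviations G C x.
          (\<forall>i\<in>C. expected_utility G i y \<ge> expected_utility G i x) \<and>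
          (\<exists>i\<in>C. expected_utility G i y > expected_utility G i x))"

definition strong_nash_equilibrium :: "'a game \<Rightarrow> (nat \<Rightarrow> 'a \<Rightarrow> real) \<Rightarrow> bool" where
  "strong_nash_equilibrium G x \<longleftrightarrow>
     nash_equilibrium G x \<and> (\<forall>C\<in>coalitions G. weakly_pareto_efficient_for G C x)"

definition super_strong_nash_equilibrium :: "'a game \<Rightarrow> (nat \<Rightarrow> 'a \<Rightarrow> real) \<Rightarrow> bool" where
  "super_strong_nash_equilibrium G x \<longleftrightarrow>
     nash_equilibrium G x \<and> (\<forall>C\<in>coalitions G. strictly_pareto_efficient_for G C x)"

end

theory Submission
  imports Defs
begin

text \<open>
  When player 3 plays 0, players 1 and 2 play matching pennies and all payoff vectors lie on the
  line through \<open>(1, -1, -2)\<close>. When player 3 plays 1, the outcome \<open>(0, 0, 1)\<close> yields \<open>(2, 0, -1)\<close>,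
  which strictly dominates \<open>(1, -1, -2)\<close>, and all other outcomes yield \<open>(-2, -2, -2)\<close>. At
  the equilibrium players 1 and 2 mix uniformly and player 3 plays 0, which gives everyone 0.
  As long as player 3 plays 0, a deviation changes payoffs only if players 1 and 2 both take part,
  and then one of them loses. Let players 1 and 2 play 0 with probabilities \<open>p\<close>, \<open>q\<close> and player 3 play 1 with positive
  probability. For player 3 not to lose, \<open>(2p - 1) (2q - 1)\<close> must be negative, so
  players 1 and 2 both deviate; but then \<open>p q < 1/2\<close>, so they miss the outcome \<open>(0, 0, 1)\<close> so often
  that player 1 loses.
\<close>

text \<open>Keeps \<open>1\<close>, which names both a player and an action, from being rewritten to
  \<open>Suc 0\<close>, so that rules stated with \<open>1\<close> still match.\<close>

declare One_nat_def [simp del]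

text \<open>The value \<open>undefined\<close> off the three players makes a triple extensional,
  hence an element of \<open>\<Pi>\<^sub>E\<close>. Outcomes, mixed profiles and payoff vectors all
  take this form.\<close>

definition triple :: "'a \<Rightarrow> 'a \<Rightarrow> 'a \<Rightarrow> nat \<Rightarrow> 'a" where
  "triple a b c = (\<lambda>_. undefined)(1 := a, 2 := b, 3 := c)"

lemma triple_simps [simp]:
  "triple a b c 1 = a" "triple a b c 2 = b" "triple a b c 3 = c"
  by (simp_all add: triple_def)

lemma triple_eq_iff: "triple a b c = triple a' b' c' \<longleftrightarrow> a = a' \<and> b = b' \<and> c = c'"
  by (metis triple_simps)

lemma atLeastAtMost_1_3: "{1..3::nat} = {1, 2, 3}"
  by auto

lemma PiE_eq_image_triple:
  "(\<Pi>\<^sub>E i\<in>{1, 2, 3::nat}. A i) = (\<lambda>(a, b, c). triple a b c) ` (A 1 \<times> A 2 \<times> A 3)"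
proof (intro equalityI subsetI)
  fix f assume f: "f \<in> (\<Pi>\<^sub>E i\<in>{1, 2, 3::nat}. A i)"
  then have "f = triple (f 1) (f 2) (f 3)"
    by (auto simp: triple_def fun_eq_iff PiE_def extensional_def)
  with f show "f \<in> (\<lambda>(a, b, c). triple a b c) ` (A 1 \<times> A 2 \<times> A 3)"
    by (intro image_eqI[of _ _ "(f 1, f 2, f 3)"]) auto
qed (auto simp: triple_def split: if_splits)

definition pennies_game :: "nat game" where
  "pennies_game =
     \<lparr>num_players = 3, actions = (\<lambda>_. {0, 1}),
      utility = (\<lambda>i a.
        if a 3 = 0 then (if a 1 = a 2 then triple 1 (-1) (-2) i else triple (-1) 1 2 i)
        else if a 1 = 0 \<and> a 2 = 0 then triple 2 0 (-1) i
        else -2)\<rparr>"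

definition pennies_equilibrium :: "nat \<Rightarrow> nat \<Rightarrow> real" where
  "pennies_equilibrium =
     (let h = (\<lambda>k. if k \<in> {0, 1} then 1 / 2 else 0) in triple h h (\<lambda>k. if k = 0 then 1 else 0))"

lemma players_pennies_game: "players pennies_game = {1, 2, 3}"
  by (simp add: players_def pennies_game_def atLeastAtMost_1_3)

lemma actions_pennies_game [simp]: "actions pennies_game i = {0, 1}"
  by (simp add: pennies_game_def)

lemma utility_pennies_game:
  "utility pennies_game i a =
     (if a 3 = 0 then (if a 1 = a 2 then triple 1 (-1) (-2) i else triple (-1) 1 2 i)
      else if a 1 = 0 \<and> a 2 = 0 then triple 2 0 (-1) i
      else -2)"
  by (simp add: pennies_game_def)

lemma outcomes_pennies_game:
  "outcomes pennies_game = (\<lambda>(a, b, c). triple a b c) ` ({0, 1} \<times> {0, 1} \<times> {0, 1})"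
  unfolding outcomes_def players_pennies_game PiE_eq_image_triple by simp

lemma mixed_profiles_pennies_game:
  "mixed_profiles pennies_game = (\<lambda>(a, b, c). triple a b c) `
     (mixed_strategies {0, 1} \<times> mixed_strategies {0, 1} \<times> mixed_strategies {0, 1})"
  unfolding mixed_profiles_def players_pennies_game PiE_eq_image_triple by simp

lemma mixed_strategies_01:
  "p \<in> mixed_strategies {0, 1::nat} \<longleftrightarrow>
     0 \<le> p 0 \<and> p 0 \<le> 1 \<and> p 1 = 1 - p 0 \<and> (\<forall>a. a \<notin> {0, 1} \<longrightarrow> p a = 0)"
  by (auto simp: mixed_strategies_def)

lemma expected_utility_pennies_game_sum:
  "expected_utility pennies_game i x =
     (\<Sum>a\<in>{0, 1}. \<Sum>b\<in>{0, 1}. \<Sum>c\<in>{0, 1}.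
        utility pennies_game i (triple a b c) * (x 1 a * x 2 b * x 3 c))"
proof -
  have "inj_on (\<lambda>(a, b, c). triple a b c) ({0, 1} \<times> {0, 1} \<times> {0, 1::nat})"
    by (auto simp: inj_on_def triple_eq_iff)
  then show ?thesis
    unfolding expected_utility_def outcomes_pennies_game players_pennies_game
    by (simp add: sum.reindex sum.cartesian_product' mult.assoc)
qed

lemma mixed_profiles_pennies_gameD:
  assumes "x \<in> mixed_profiles pennies_game" "i \<in> {1, 2, 3}"
  shows "0 \<le> x i 0" "x i 0 \<le> 1" "x i 1 = 1 - x i 0"
proof -
  have "x i \<in> mixed_strategies {0, 1}"
    using assms by (auto simp: mixed_profiles_def players_pennies_game PiE_iff)
  then show "0 \<le> x i 0" "x i 0 \<le> 1" "x i 1 = 1 - x i 0"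
    unfolding mixed_strategies_01 by blast+
qed

text \<open>If player 3 plays 0, the product \<open>(2 * x 1 0 - 1) * (2 * x 2 0 - 1)\<close> is the
  probability of a match minus that of a mismatch. If player 3 plays 1, the good outcome has
  probability \<open>x 1 0 * x 2 0\<close> and everything else pays -2.\<close>

lemma expected_utility_pennies_game:
  assumes "x \<in> mixed_profiles pennies_game"
  shows
    "expected_utility pennies_game 1 x =
       (1 - x 3 1) * ((2 * x 1 0 - 1) * (2 * x 2 0 - 1)) + x 3 1 * (4 * (x 1 0 * x 2 0) - 2)"
    "expected_utility pennies_game 2 x =
       - ((1 - x 3 1) * ((2 * x 1 0 - 1) * (2 * x 2 0 - 1))) + x 3 1 * (2 * (x 1 0 * x 2 0) - 2)"
    "expected_utility pennies_game 3 x =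
       - 2 * ((1 - x 3 1) * ((2 * x 1 0 - 1) * (2 * x 2 0 - 1))) + x 3 1 * (x 1 0 * x 2 0 - 2)"
  by (simp_all add: expected_utility_pennies_game_sum utility_pennies_game
      mixed_profiles_pennies_gameD(3)[OF assms]) algebra+

lemma pennies_equilibrium_in_mixed_profiles:
  "pennies_equilibrium \<in> mixed_profiles pennies_game"
  by (auto simp: pennies_equilibrium_def mixed_profiles_pennies_game mixed_strategies_01 Let_def
      intro!: image_eqI[of _ _ "(_, _, _)"])

lemma pennies_equilibrium_simps:
  "pennies_equilibrium 1 0 = 1 / 2" "pennies_equilibrium 2 0 = 1 / 2"
  "pennies_equilibrium 3 1 = 0"
  by (simp_all add: pennies_equilibrium_def Let_def)

lemma expected_utility_pennies_equilibrium:
  assumes "i \<in> players pennies_game"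
  shows "expected_utility pennies_game i pennies_equilibrium = 0"
  using assms expected_utility_pennies_game[OF pennies_equilibrium_in_mixed_profiles]
  by (auto simp: players_pennies_game pennies_equilibrium_simps)

lemma strictly_pareto_efficient_pennies_equilibrium:
  assumes C: "C \<in> coalitions pennies_game"
  shows "strictly_pareto_efficient_for pennies_game C pennies_equilibrium"
  unfolding strictly_pareto_efficient_for_def
proof
  let ?u = "expected_utility pennies_game"
  have sub: "C \<subseteq> {1, 2, 3}"
    using C by (simp add: coalitions_def players_pennies_game)
  assume "\<exists>y\<in>coalition_deviations pennies_game C pennies_equilibrium.
      (\<forall>i\<in>C. ?u i y \<ge> ?u i pennies_equilibrium) \<and> (\<exists>i\<in>C. ?u i y > ?u i pennies_equilibrium)"
  then obtain y k where y: "y \<in> mixed_profiles pennies_game"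
    and fixed: "\<And>i. i \<in> {1, 2, 3} \<Longrightarrow> i \<notin> C \<Longrightarrow> y i = pennies_equilibrium i"
    and nonneg: "\<And>i. i \<in> C \<Longrightarrow> ?u i y \<ge> 0" and k: "k \<in> C" "?u k y > 0"
    using sub by (auto simp: coalition_deviations_def players_pennies_game subset_iff
        expected_utility_pennies_equilibrium)
  \<comment> \<open>\<open>p\<close> and \<open>q\<close> are weights of action 0 but
    \<open>t\<close> is the weight of action 1, so the equilibrium has \<open>p = q = 1 / 2\<close>
    and \<open>t = 0\<close>.\<close>
  define p q t s where "p = y 1 0" and "q = y 2 0" and "t = y 3 1"
    and s: "s = (2 * p - 1) * (2 * q - 1)"
  note u = expected_utility_pennies_game[OF y, folded p_def q_def t_def, folded s]
  have bounds: "0 \<le> p" "p \<le> 1" "0 \<le> q" "q \<le> 1" "0 \<le> t" "t \<le> 1"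
    using mixed_profiles_pennies_gameD[OF y] by (simp_all add: p_def q_def t_def)
  have pq: "0 \<le> p * q" "p * q \<le> 1"
    using bounds by (auto intro: mult_le_one)
  \<comment> \<open>A player who keeps to the uniform mixture annihilates a factor of
    \<open>s\<close>.\<close>
  have s1: "s = 0" if "1 \<notin> C"
    using fixed[of 1] that by (simp add: s p_def pennies_equilibrium_simps)
  have s2: "s = 0" if "2 \<notin> C"
    using fixed[of 2] that by (simp add: s q_def pennies_equilibrium_simps)
  have t3: "t = 0" if "3 \<notin> C"
    using fixed[of 3] that by (simp add: t_def pennies_equilibrium_simps)
  have "t = 0"
  proof (rule ccontr)
    assume "t \<noteq> 0"
    with bounds t3 have t: "t > 0" "3 \<in> C"
      by auto
    \<comment> \<open>Playing 1 always costs player 3 something, so only a negative \<open>s\<close>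
      can compensate.\<close>
    have "t * (p * q - 2) < 0"
      using t pq by (intro mult_pos_neg) auto
    with nonneg[OF t(2)] u(3) have neg: "(1 - t) * s < 0"
      by simp
    with bounds have "s < 0"
      by (auto simp: mult_less_0_iff)
    with s1 have "1 \<in> C"
      by auto
    \<comment> \<open>The factors of \<open>s\<close> have opposite signs; the weight below 1/2
      bounds \<open>p * q\<close>, as the other is at most 1.\<close>
    have "p < 1 / 2 \<or> q < 1 / 2"
      using \<open>s < 0\<close> by (auto simp: s mult_less_0_iff)
    then have "p * q < 1 / 2"
      using bounds mult_left_le[of q p] mult_left_le_one_le[of q p] by auto
    then have "t * (4 * (p * q) - 2) < 0"
      using t by (intro mult_pos_neg) auto
    with neg u(1) nonneg[OF \<open>1 \<in> C\<close>] show False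
      by simp
  qed
  then have u: "?u 1 y = s" "?u 2 y = - s" "?u 3 y = - 2 * s"
    using u by auto
  have "s = 0"
  proof (rule ccontr)
    assume "s \<noteq> 0"
    then have "1 \<in> C" "2 \<in> C"
      using s1 s2 by auto
    \<comment> \<open>Players 1 and 2 now play a zero-sum game, so they cannot both avoid a loss
      unless \<open>s = 0\<close>.\<close>
    with nonneg[of 1] nonneg[of 2] u \<open>s \<noteq> 0\<close> show False
      by linarith
  qed
  with u k sub show False
    by auto
qed

text \<open>A unilateral deviation is a deviation of the coalition \<open>{i}\<close>, for which
  strict efficiency rules out any gain.\<close>

lemma nash_equilibrium_if_super:
  assumes "x \<in> mixed_profiles G" "\<And>C. C \<in> coalitions G \<Longrightarrow> strictly_pareto_efficient_for G C x"
  shows "nash_equilibrium G x"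
  unfolding nash_equilibrium_def
proof (intro conjI ballI)
  fix i p assume ip: "i \<in> players G" "p \<in> mixed_strategies (actions G i)"
  have "x(i := p) \<in> mixed_profiles G"
    using assms(1) ip by (auto simp: mixed_profiles_def PiE_iff extensional_def)
  then have "x(i := p) \<in> coalition_deviations G {i} x"
    by (auto simp: coalition_deviations_def)
  moreover have "strictly_pareto_efficient_for G {i} x"
    using assms(2)[of "{i}"] ip by (simp add: coalitions_def)
  ultimately show "expected_utility G i x \<ge> expected_utility G i (x(i := p))"
    by (fastforce simp: strictly_pareto_efficient_for_def)
qed (fact assms(1))

text \<open>As coalitions are nonempty, a strict gain for all members includes a strict gain for at
  least one.\<close>

lemma strong_nash_equilibrium_if_super:
  assumes "super_strong_nash_equilibrium G x"
  shows "strong_nash_equilibrium G x"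
proof -
  have "weakly_pareto_efficient_for G C x" if "C \<in> coalitions G" for C
  proof -
    have "strictly_pareto_efficient_for G C x" "C \<noteq> {}"
      using assms that by (auto simp: super_strong_nash_equilibrium_def coalitions_def)
    then show ?thesis
      unfolding strictly_pareto_efficient_for_def weakly_pareto_efficient_for_def
      by (meson all_not_in_conv less_imp_le)
  qed
  then show ?thesis
    using assms by (simp add: super_strong_nash_equilibrium_def strong_nash_equilibrium_def)
qed

lemma pure_profile_in_mixed_profiles:
  assumes "finite_game G" "a \<in> outcomes G"
  shows "pure_profile G a \<in> mixed_profiles G"
  using assms
  by (auto simp: pure_profile_def mixed_profiles_def mixed_strategies_def finite_game_def
      outcomes_def PiE_iff sum.delta)

lemma finite_pennies_game: "finite_game pennies_game"
  by (simp add: finite_game_def players_pennies_game)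

lemma pennies_equilibrium_not_pure: "\<not> is_pure pennies_game pennies_equilibrium"
proof
  assume "is_pure pennies_game pennies_equilibrium"
  then obtain a where a: "pennies_equilibrium = pure_profile pennies_game a"
    by (auto simp: is_pure_def)
  \<comment> \<open>The weight 1/2 on the left is neither 0 nor 1.\<close>
  have "pennies_equilibrium 1 0 = (if 0 = a 1 then 1 else 0)"
    unfolding a by (simp add: pure_profile_def players_pennies_game)
  then show False
    by (simp add: pennies_equilibrium_simps split: if_splits)
qed

lemma dominated_outcome_in_support:
  "triple 0 0 0 \<in> support pennies_game pennies_equilibrium"
  by (auto simp: support_def outcomes_pennies_game players_pennies_game pennies_equilibrium_def
      Let_def intro!: image_eqI[of _ _ "(0, 0, 0)"])

lemma strictly_pareto_dominated_outcome:
  "strictly_pareto_dominated pennies_game (pure_profile pennies_game (triple 0 0 0))"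
proof -
  have mem: "pure_profile pennies_game (triple 0 0 c) \<in> mixed_profiles pennies_game"
    if "c \<in> {0, 1}" for c
    using that finite_pennies_game
    by (intro pure_profile_in_mixed_profiles) (auto simp: outcomes_pennies_game)
  \<comment> \<open>Switching player 3 to action 1 raises the payoffs from (1, -1, -2) to (2, 0,
    -1).\<close>
  have "expected_utility pennies_game i (pure_profile pennies_game (triple 0 0 0))
      < expected_utility pennies_game i (pure_profile pennies_game (triple 0 0 1))"
    if "i \<in> players pennies_game" for i
    using that expected_utility_pennies_game[OF mem[of 0]] expected_utility_pennies_game[OF mem[of 1]]
    by (auto simp: players_pennies_game pure_profile_def)
  then show ?thesis
    using mem[of 1] by (auto simp: strictly_pareto_dominated_def)
qed

theorem proposition4p1:
  "(\<exists>(G :: nat game) x. finite_game G \<and> num_players G = 3 \<and>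
      strong_nash_equilibrium G x \<and> \<not> is_pure G x \<and>
      (\<exists>a\<in>support G x. strictly_pareto_dominated G (pure_profile G a))) \<and>
   (\<exists>(G :: nat game) x. finite_game G \<and> num_players G = 3 \<and>
      super_strong_nash_equilibrium G x \<and> \<not> is_pure G x \<and>
      (\<exists>a\<in>support G x. strictly_pareto_dominated G (pure_profile G a)))"
proof -
  have super: "super_strong_nash_equilibrium pennies_game pennies_equilibrium"
    unfolding super_strong_nash_equilibrium_def
    using nash_equilibrium_if_super pennies_equilibrium_in_mixed_profiles
      strictly_pareto_efficient_pennies_equilibrium by blast
  have "num_players pennies_game = 3"
    by (simp add: pennies_game_def)
  with super strong_nash_equilibrium_if_super[OF super] finite_pennies_game
    pennies_equilibrium_not_pure dominated_outcome_in_support strictly_pareto_dominated_outcome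
  show ?thesis
    by blast
qed

end
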